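(* Let $A\in\mathbb{R}^{n\times d}$ be a nonzero matrix, $b\in\mathbb{R}^n$, $T\in\mathbb{N}$, and let $\mathcal{T}$ be a $(\overline{p},\overline{\alpha},\overline{\beta})$ column paving of $A$. Let $x_T$ be the output of the Randomized Block Least Squares Solver (described in the context) run for $T$ iterations on input $A,b$ with column partition $\mathcal{T}$. Then $$\mathbb{E}\|A(x_{LS}-x_T)\|_2^2\le\left(1-\frac{\sigma_{\min}^2(A)}{\overline{p}\,\overline{\beta}}\right)^T\|b_{\mathcal{R}(A)}\|_2^2.$$
   Context: Notation: $A^\dagger$ is the Moore-Penrose pseudoinverse; $x_{LS}=A^\dagger b$; $b_{\mathcal{R}(A)}=AA^\dagger b$ is the orthogonal projection of $b$ onto the range of $A$; $\sigma_{\min}(A)$ is the smallest nonzero singular value of $A$. No full-rank assumption is made on $A$. Column paving: a $(\overline{p},\overline{\alpha},\overline{\beta})$ column paving of an $n\times d$ matrix $A$ is a partition $\{\tau_1,\dots,\tau_{\overline{p}}\}$ of the column index set $[d]=\{1,\dots,d\}$ into $\overline{p}$ nonempty blocks such that for each block $\tau$, $\overline{\alpha}\le\lambda_{\min}(A_\tau^*A_\tau)$ and $\lambda_{\max}(A_\tau^*A_\tau)\le\overline{\beta}$, where $A_\tau$ is the $n\times|\tau|$ submatrix of $A$ with columns indexed by $\tau$. Randomized Block Least Squares Solver: given a column partition $\mathcal{T}$ of $[d]$, set $x_0=0\in\mathbb{R}^d$ and $z_0=b$. For $k=1,2,\dots,T$: pick $\tau_k\in\mathcal{T}$ uniformly at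 random (independently of previous picks); compute $w_k=(A_{\tau_k})^\dagger z_{k-1}$; update $(x_k)_{\tau_k}=(x_{k-1})_{\tau_k}+w_k$, leaving the coordinates of $x_{k-1}$ outside $\tau_k$ unchanged; set $z_k=z_{k-1}-A_{\tau_k}w_k$. Output $x_T$. Here $v_\tau$ denotes the restriction of a vector $v$ to the coordinates in $\tau$. The expectation is over all random picks. *)

theory Defs
  imports
    "HOL-Probability.Probability_Mass_Function"
    "Jordan_Normal_Form.Char_Poly"
    "Jordan_Normal_Form.DL_Submatrix"
    "HOL-Library.Disjoint_Sets"
begin

unbundle no inner_syntax
unbundle no vec_syntax
hide_type (open) Finite_Cartesian_Product.vec
hide_const (open) Finite_Cartesian_Product.vec Finite_Cartesian_Product.mat

definition l2norm :: "real vec \<Rightarrow> real" where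
  "l2norm v = sqrt (v \<bullet> v)"

text \<open>The Moore-Penrose pseudoinverse, as the unique solution of the four Penrose equations.\<close>

definition pinv :: "real mat \<Rightarrow> real mat" where
  "pinv A = (THE X. X \<in> carrier_mat (dim_col A) (dim_row A) \<and>
     A * X * A = A \<and> X * A * X = X \<and>
     transpose_mat (A * X) = A * X \<and> transpose_mat (X * A) = X * A)"

text \<open>Only meant for symmetric matrices of positive dimension: there the set of eigenvalues is
  finite and nonempty.\<close>

definition lambda_min :: "real mat \<Rightarrow> real" where
  "lambda_min M = Min {k. eigenvalue M k}"

definition lambda_max :: "real mat \<Rightarrow> real" where
  "lambda_max M = Max {k. eigenvalue M k}"

text \<open>The set of singular values may contain or omit 0 when the matrix is not square, depending on the
  convention; this does not matter for the smallest nonzero one. For the zero matrix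
  \<open>sigma_min\<close> is unspecified.\<close>

definition singular_values :: "real mat \<Rightarrow> real set" where
  "singular_values A = {s. 0 \<le> s \<and> eigenvalue (transpose_mat A * A) (s\<^sup>2)}"

definition sigma_min :: "real mat \<Rightarrow> real" where
  "sigma_min A = Min (singular_values A - {0})"

text \<open>Columns are indexed from 0. The columns of \<open>col_submatrix A \<tau>\<close> are the columns of \<open>A\<close> with
  index in \<open>\<tau>\<close>, in increasing order of the index.\<close>

definition col_submatrix :: "real mat \<Rightarrow> nat set \<Rightarrow> real mat" where
  "col_submatrix A \<tau> = submatrix A UNIV \<tau>"

definition column_paving ::
  "real mat \<Rightarrow> nat set set \<Rightarrow> nat \<Rightarrow> real \<Rightarrow> real \<Rightarrow> bool" where
  "column_paving A \<T> p \<alpha> \<beta> \<longleftrightarrow>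
     partition_on {0..<dim_col A} \<T> \<and> card \<T> = p \<and>
     (\<forall>\<tau>\<in>\<T>. \<alpha> \<le> lambda_min (transpose_mat (col_submatrix A \<tau>) * col_submatrix A \<tau>) \<and>
            lambda_max (transpose_mat (col_submatrix A \<tau>) * col_submatrix A \<tau>) \<le> \<beta>)"

text \<open>Adds \<open>w\<close>, whose length is \<open>card \<tau>\<close>, to the coordinates of \<open>x\<close> in \<open>\<tau>\<close>: an index \<open>i \<in> \<tau>\<close>
  has position \<open>card {j \<in> \<tau>. j < i}\<close> in the increasing enumeration of \<open>\<tau>\<close>.\<close>

definition add_on_block :: "real vec \<Rightarrow> nat set \<Rightarrow> real vec \<Rightarrow> real vec" where
  "add_on_block x \<tau> w = vec (dim_vec x)
     (\<lambda>i. if i \<in> \<tau> then x $ i + w $ card {j \<in> \<tau>. j < i} else x $ i)"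

definition rbls_step ::
  "real mat \<Rightarrow> nat set \<Rightarrow> real vec \<times> real vec \<Rightarrow> real vec \<times> real vec" where
  "rbls_step A \<tau> = (\<lambda>(x, z).
     let w = pinv (col_submatrix A \<tau>) *\<^sub>v z
     in (add_on_block x \<tau> w, z - col_submatrix A \<tau> *\<^sub>v w))"

text \<open>The joint distribution of the iterates \<open>(x\<^sub>k, z\<^sub>k)\<close>; each block is drawn afresh, hence
  independently of the previous ones.\<close>

primrec rbls_state ::
  "real mat \<Rightarrow> real vec \<Rightarrow> nat set set \<Rightarrow> nat \<Rightarrow> (real vec \<times> real vec) pmf" where
  "rbls_state A b \<T> 0 = return_pmf (0\<^sub>v (dim_col A), b)"
| "rbls_state A b \<T> (Suc k) =
     bind_pmf (rbls_state A b \<T> k) (\<lambda>s.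
     bind_pmf (pmf_of_set \<T>) (\<lambda>\<tau>.
     return_pmf (rbls_step A \<tau> s)))"

definition rbls :: "real mat \<Rightarrow> real vec \<Rightarrow> nat set set \<Rightarrow> nat \<Rightarrow> real vec pmf" where
  "rbls A b \<T> T = map_pmf fst (rbls_state A b \<T> T)"

definition x_LS :: "real mat \<Rightarrow> real vec \<Rightarrow> real vec" where
  "x_LS A b = pinv A *\<^sub>v b"

definition range_proj :: "real mat \<Rightarrow> real vec \<Rightarrow> real vec" where
  "range_proj A b = A * pinv A *\<^sub>v b"

end

theory Submission
  imports Defs "Jordan_Normal_Form.Schur_Decomposition" "Jordan_Normal_Form.Spectral_Radius"
begin

text \<open>The iterates satisfy \<open>z = b - A x\<close>, so the error \<open>e = A (x\<^sub>L\<^sub>S - x)\<close> is the part of \<open>z\<close> in the range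
  of \<open>A\<close>. Write \<open>P\<^sub>\<tau>\<close> for the orthogonal projection onto the range of \<open>A\<^sub>\<tau>\<close>. A step with block \<open>\<tau>\<close>
  replaces \<open>e\<close> by \<open>e - P\<^sub>\<tau> e\<close>, which lowers \<open>\<parallel>e\<parallel>\<^sup>2\<close> by \<open>\<parallel>P\<^sub>\<tau> e\<parallel>\<^sup>2\<close>. Since \<open>A\<^sub>\<tau>\<^sup>T P\<^sub>\<tau> = A\<^sub>\<tau>\<^sup>T\<close>, we have
  \<open>\<parallel>A\<^sub>\<tau>\<^sup>T e\<parallel>\<^sup>2 \<le> \<beta> \<parallel>P\<^sub>\<tau> e\<parallel>\<^sup>2\<close>. Summing over the blocks,
  \<open>\<beta> \<Sum>\<^sub>\<tau> \<parallel>P\<^sub>\<tau> e\<parallel>\<^sup>2 \<ge> \<parallel>A\<^sup>T e\<parallel>\<^sup>2 \<ge> \<sigma>\<^sub>m\<^sub>i\<^sub>n\<^sup>2 \<parallel>e\<parallel>\<^sup>2\<close>, so the mean of \<open>\<parallel>e\<parallel>\<^sup>2\<close> contracts by the claimed rate.\<close>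

subsection \<open>The spectral theorem for real symmetric matrices\<close>

text \<open>A complex eigenvalue \<open>k\<close> exists. As \<open>C\<close> is real and symmetric,
  moving it across the Hermitian product of \<open>u\<close> with itself gives
  \<open>k = cnj k\<close>.\<close>

lemma real_symmetric_has_eigenvector:
  fixes M :: "real mat"
  assumes M: "M \<in> carrier_mat n n" and sym: "M\<^sup>T = M" and n: "n > 0"
  obtains e v where "v \<in> carrier_vec n" "v \<noteq> 0\<^sub>v n" "M *\<^sub>v v = e \<cdot>\<^sub>v v"
proof -
  define C where "C = map_mat complex_of_real M"
  have C: "C \<in> carrier_mat n n" using M by (simp add: C_def)
  have symC: "C\<^sup>T = C" unfolding C_def map_mat_transpose sym ..
  obtain k where k: "eigenvalue C k"
    using spectrum_non_empty[OF C n] by (auto simp: spectrum_def)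
  then obtain u where u: "u \<in> carrier_vec n" "u \<noteq> 0\<^sub>v n" and Cu: "C *\<^sub>v u = k \<cdot>\<^sub>v u"
    using C by (auto simp: eigenvalue_def eigenvector_def)
  let ?c = "u \<bullet> conjugate u"
  have "k * ?c = (C\<^sup>T *\<^sub>v u) \<bullet> conjugate u"
    using u by (simp add: symC Cu)
  also have "\<dots> = u \<bullet> (C *\<^sub>v conjugate u)"
    by (rule transpose_vec_mult_scalar) (use C u in auto)
  also have "C *\<^sub>v conjugate u = conjugate (C *\<^sub>v u)"
    using M u by (intro eq_vecI) (auto simp: C_def scalar_prod_def)
  also have "u \<bullet> conjugate (C *\<^sub>v u) = cnj k * ?c"
    using u by (simp add: Cu conjugate_smult_vec)
  finally have "k * ?c = cnj k * ?c" .
  moreover have "?c \<noteq> 0" using u by (simp add: conjugate_square_eq_0_vec[of u n])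
  ultimately have "k = cnj k" by simp
  then have kr: "k = complex_of_real (Re k)" by (simp add: complex_eq_iff)
  interpret of_real_hom: comm_ring_hom complex_of_real by unfold_locales auto
  \<comment> \<open>The vector \<open>u\<close> may be complex; a real eigenvector comes instead
    from the real root of the characteristic polynomial of \<open>M\<close>.\<close>
  have "poly (map_poly complex_of_real (char_poly M)) (complex_of_real (Re k)) = 0"
    using k kr unfolding eigenvalue_root_char_poly[OF C] by (simp add: C_def of_real_hom.char_poly_hom[OF M])
  then have "poly (char_poly M) (Re k) = 0" by simp
  then have "eigenvalue M (Re k)" unfolding eigenvalue_root_char_poly[OF M] .
  then show thesis using that M by (auto simp: eigenvalue_def eigenvector_def)
qed

text \<open>Gram-Schmidt on a basis completion of \<open>v\<close> keeps \<open>v\<close> as its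
  first vector; normalising yields \<open>W\<close>. This change of basis splits off an eigenvector
  below.\<close>

lemma orthogonal_mat_with_first_col:
  fixes v :: "real vec"
  assumes v: "v \<in> carrier_vec n" and v0: "v \<noteq> 0\<^sub>v n"
  obtains W c where "W \<in> carrier_mat n n" "W\<^sup>T * W = 1\<^sub>m n" "col W 0 = c \<cdot>\<^sub>v v"
proof -
  interpret cof_vec_space n "TYPE(real)" .
  define b where "b = basis_completion v"
  define ws where "ws = gram_schmidt n b"
  note bc = basis_completion[OF v v0, folded b_def]
  have n: "n > 0" using v v0 by (cases n) auto
  obtain vs where bv: "b = v # vs" using bc(6,7) n by (cases b) auto
  have ws: "set ws \<subseteq> carrier_vec n" "corthogonal ws" "length ws = n"
    using gram_schmidt_result[OF bc(2) bc(4) bc(5) ws_def] bc(6) by auto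
  have hd: "ws ! 0 = v" using gram_schmidt_hd[OF v, of vs] ws(3) n
    unfolding ws_def bv by (metis hd_conv_nth list.size(3) less_irrefl)
  have wsc: "ws ! i \<in> carrier_vec n" if "i < n" for i using ws that by auto
  \<comment> \<open>The case \<open>i = j\<close> says that no \<open>ws ! i\<close> has norm zero,
    so \<open>c i\<close> is a true inverse length.\<close>
  have orth: "(ws ! i \<bullet> ws ! j = 0) = (i \<noteq> j)" if "i < n" "j < n" for i j
    using corthogonalD[OF ws(2), of i j] that ws(3) by simp
  define c where "c i = 1 / sqrt (ws ! i \<bullet> ws ! i)" for i
  define W where "W = mat_of_cols n (map (\<lambda>i. c i \<cdot>\<^sub>v ws ! i) [0..<n])"
  have W: "W \<in> carrier_mat n n" unfolding W_def by auto
  have colW: "col W i = c i \<cdot>\<^sub>v ws ! i" if "i < n" for i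
    unfolding W_def using that wsc[OF that] by (subst col_mat_of_cols) auto
  have pos: "c i * (c i * (ws ! i \<bullet> ws ! i)) = 1" if "i < n" for i
  proof -
    have "ws ! i \<bullet> ws ! i \<ge> 0" by (simp add: scalar_prod_def sum_nonneg)
    then show ?thesis using orth[OF that that] unfolding c_def by (simp add: field_simps)
  qed
  have "W\<^sup>T * W = 1\<^sub>m n"
  proof (rule eq_matI)
    fix i j assume "i < dim_row (1\<^sub>m n)" "j < dim_col (1\<^sub>m n)"
    then have ij: "i < n" "j < n" by auto
    then show "(W\<^sup>T * W) $$ (i, j) = 1\<^sub>m n $$ (i, j)"
      using W wsc[OF ij(1)] wsc[OF ij(2)] orth[OF ij] pos by (auto simp: colW)
  qed (use W in auto)
  moreover have "col W 0 = c 0 \<cdot>\<^sub>v v" using colW[OF n] hd by simp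
  ultimately show thesis using that W by blast
qed

text \<open>Deflation: an orthogonal \<open>W\<close> with an eigenvector as first column turns
  \<open>M\<close> into a block diagonal \<open>N\<close> made of the eigenvalue \<open>e\<close>
  and a smaller symmetric \<open>K\<close>. The decomposition of \<open>K\<close> is extended by a
  leading 1 to \<open>Q\<close>, and \<open>W * Q\<close> diagonalises \<open>M\<close>.\<close>

theorem real_spectral_decomposition:
  fixes M :: "real mat"
  assumes "M \<in> carrier_mat n n" "M\<^sup>T = M"
  shows "\<exists>P d. P \<in> carrier_mat n n \<and> P\<^sup>T * P = 1\<^sub>m n \<and> P * P\<^sup>T = 1\<^sub>m n \<and>
    M = P * mat_diag n d * P\<^sup>T"
  using assms
proof (induction n arbitrary: M)
  case 0
  then have "M = 1\<^sub>m 0 * mat_diag 0 (\<lambda>_. 0) * (1\<^sub>m 0)\<^sup>T"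
    by (intro eq_matI) (auto simp: mat_diag_def)
  then show ?case by (intro exI[of _ "1\<^sub>m 0"] exI[of _ "\<lambda>_. 0"]) auto
next
  case (Suc m M)
  let ?n = "Suc m"
  note M = Suc.prems(1) and sym = Suc.prems(2)
  obtain e v where v: "v \<in> carrier_vec ?n" "v \<noteq> 0\<^sub>v ?n" and ev: "M *\<^sub>v v = e \<cdot>\<^sub>v v"
    using real_symmetric_has_eigenvector[OF M sym zero_less_Suc] .
  obtain W c where W: "W \<in> carrier_mat ?n ?n" and WW: "W\<^sup>T * W = 1\<^sub>m ?n" and col: "col W 0 = c \<cdot>\<^sub>v v"
    using orthogonal_mat_with_first_col[OF v] .
  have WT: "W\<^sup>T \<in> carrier_mat ?n ?n" using W by simp
  have WW': "W * W\<^sup>T = 1\<^sub>m ?n" using mat_mult_left_right_inverse[OF WT W WW] .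
  note assoc = assoc_mult_mat[of _ ?n ?n _ ?n _ ?n] mult_carrier_mat[of _ ?n ?n _ ?n]
  define N where "N = W\<^sup>T * M * W"
  have N: "N \<in> carrier_mat ?n ?n" using W M unfolding N_def by auto
  have MN: "M = W * N * W\<^sup>T"
  proof -
    have "W * N * W\<^sup>T = (W * W\<^sup>T) * M * (W * W\<^sup>T)" using W M WT by (simp add: N_def assoc)
    then show ?thesis using M by (simp add: WW')
  qed
  have symN: "N\<^sup>T = N"
    unfolding N_def using W M WT sym
    by (simp add: transpose_mult[of _ ?n ?n _ ?n] assoc)
  \<comment> \<open>The first column of \<open>N\<close> is \<open>e\<close> times that of
    \<open>W\<^sup>T * W\<close>; symmetry of \<open>N\<close> then clears the first row as
    well.\<close>
  have N0: "N $$ (i, 0) = (if i = 0 then e else 0)" if i: "i < ?n" for i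
  proof -
    have "M *\<^sub>v col W 0 = e \<cdot>\<^sub>v col W 0"
      using M v unfolding col by (simp add: mult_mat_vec ev smult_smult_assoc mult.commute)
    then have "col (M * W) 0 = e \<cdot>\<^sub>v col W 0" by (subst col_mult2[OF M W]) auto
    then have "N $$ (i, 0) = e * (col W i \<bullet> col W 0)"
      using W M i WT by (simp add: N_def assoc)
    moreover have "col W i \<bullet> col W 0 = (W\<^sup>T * W) $$ (i, 0)" using W i by simp
    ultimately show ?thesis using i by (simp add: WW)
  qed
  define K where "K = mat m m (\<lambda>(i, j). N $$ (Suc i, Suc j))"
  have K: "K \<in> carrier_mat m m" by (simp add: K_def)
  have Nsw: "N $$ (i, j) = N $$ (j, i)" if "i < ?n" "j < ?n" for i j
    using arg_cong[OF symN, of "\<lambda>X. X $$ (i, j)"] that N by simp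
  have "K\<^sup>T = K" by (rule eq_matI) (auto simp: K_def Nsw)
  from Suc.IH[OF K this] obtain P d where P: "P \<in> carrier_mat m m" "P\<^sup>T * P = 1\<^sub>m m"
    "P * P\<^sup>T = 1\<^sub>m m" and KP: "K = P * mat_diag m d * P\<^sup>T" by blast
  define E where "E = mat 1 1 (\<lambda>_. e)"
  define d' where "d' = case_nat e d"
  define Q where "Q = four_block_mat (1\<^sub>m 1) (0\<^sub>m 1 m) (0\<^sub>m m 1) P"
  have Q: "Q \<in> carrier_mat ?n ?n" using P unfolding Q_def by auto
  have QT: "Q\<^sup>T = four_block_mat (1\<^sub>m 1) (0\<^sub>m 1 m) (0\<^sub>m m 1) (P\<^sup>T)"
    unfolding Q_def using P by (subst transpose_four_block_mat[of _ 1 1 _ m _ m]) auto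
  have QTc: "Q\<^sup>T \<in> carrier_mat ?n ?n" using Q by simp
  have QQ: "Q\<^sup>T * Q = 1\<^sub>m ?n"
    unfolding QT unfolding Q_def using P
    by (subst mult_four_block_mat[of _ 1 1 _ m _ m _ _ 1 _ m]) auto
  have E: "E \<in> carrier_mat 1 1" by (simp add: E_def)
  have D: "mat_diag ?n d' = four_block_mat E (0\<^sub>m 1 m) (0\<^sub>m m 1) (mat_diag m d)"
    by (rule eq_matI) (auto simp: mat_diag_def E_def d'_def split: nat.splits)
  have dm: "mat_diag m d \<in> carrier_mat m m" by simp
  have Pd: "P * mat_diag m d \<in> carrier_mat m m" using mult_carrier_mat[OF P(1) dm] .
  have PT: "P\<^sup>T \<in> carrier_mat m m" using P by simp
  have "Q * mat_diag ?n d' = four_block_mat E (0\<^sub>m 1 m) (0\<^sub>m m 1) (P * mat_diag m d)"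
    unfolding D Q_def using P E dm Pd
    by (subst mult_four_block_mat[of _ 1 1 _ m _ m _ _ 1 _ m]) (auto simp: left_mult_zero_mat[OF dm])
  then have "Q * mat_diag ?n d' * Q\<^sup>T = four_block_mat E (0\<^sub>m 1 m) (0\<^sub>m m 1) K"
    unfolding QT KP using PT E Pd
    by (simp only:, subst mult_four_block_mat[of _ 1 1 _ m _ m _ _ 1 _ m])
      (auto simp: right_mult_zero_mat[OF Pd] left_add_zero_mat[OF mult_carrier_mat[OF Pd PT]])
  also have "\<dots> = N"
    using N N0 Nsw[of 0] by (intro eq_matI) (auto simp: E_def K_def)
  finally have QN: "N = Q * mat_diag ?n d' * Q\<^sup>T" ..
  define R where "R = W * Q"
  have R: "R \<in> carrier_mat ?n ?n" using W Q unfolding R_def by auto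
  have RT: "R\<^sup>T = Q\<^sup>T * W\<^sup>T" unfolding R_def using W Q by (simp add: transpose_mult)
  have "R\<^sup>T * R = Q\<^sup>T * (W\<^sup>T * W) * Q"
    unfolding RT unfolding R_def using W Q WT QTc by (simp add: assoc)
  then have RR: "R\<^sup>T * R = 1\<^sub>m ?n" using Q by (simp add: WW QQ)
  moreover have "R * R\<^sup>T = 1\<^sub>m ?n" using mat_mult_left_right_inverse[OF _ R RR] R by simp
  moreover have "M = R * mat_diag ?n d' * R\<^sup>T"
    unfolding RT unfolding R_def MN QN using W Q WT QTc by (simp add: assoc)
  ultimately show ?case using R by blast
qed

section \<open>Squared norms and quadratic forms in an eigenbasis\<close>

lemma scalar_prod_self_nonneg:
  fixes v :: "real vec"
  shows "v \<bullet> v \<ge> 0"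
  by (simp add: scalar_prod_def sum_nonneg)

lemma scalar_prod_self_eq_0_iff:
  fixes v :: "real vec"
  assumes "v \<in> carrier_vec n"
  shows "v \<bullet> v = 0 \<longleftrightarrow> v = 0\<^sub>v n"
  using conjugate_square_eq_0_vec[OF assms] by simp

lemma l2norm_sq: "(l2norm v)\<^sup>2 = v \<bullet> v"
  by (simp add: l2norm_def scalar_prod_self_nonneg)

text \<open>\<open>f v\<close> holds the coordinates of \<open>v\<close> in an orthonormal
  eigenbasis, where both forms are diagonal. Comparing the forms thus reduces to comparing
  \<open>d i\<close> with \<open>(d i)\<^sup>2\<close> for each eigenvalue.\<close>

lemma real_spectral_sums:
  fixes M :: "real mat"
  assumes M: "M \<in> carrier_mat n n" and sym: "M\<^sup>T = M"
  shows "\<exists>d f. (\<forall>i<n. eigenvalue M (d i)) \<and> (\<forall>v\<in>carrier_vec n.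
    v \<bullet> (M *\<^sub>v v) = (\<Sum>i<n. d i * (f v i)\<^sup>2) \<and>
    (M *\<^sub>v v) \<bullet> (M *\<^sub>v v) = (\<Sum>i<n. (d i)\<^sup>2 * (f v i)\<^sup>2))"
proof -
  obtain P d where P: "P \<in> carrier_mat n n" and PP: "P\<^sup>T * P = 1\<^sub>m n" "P * P\<^sup>T = 1\<^sub>m n"
    and MP: "M = P * mat_diag n d * P\<^sup>T" using real_spectral_decomposition[OF M sym] by blast
  have PT: "P\<^sup>T \<in> carrier_mat n n" using P by simp
  note assoc = assoc_mult_mat[of _ n n _ n _ n] mult_carrier_mat[of _ n n _ n]
    left_mult_one_mat[of _ n n] right_mult_one_mat[of _ n n]
  have M1: "M * P = P * mat_diag n d" and M2: "P\<^sup>T * M = mat_diag n d * P\<^sup>T"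
  proof -
    have "M * P = P * mat_diag n d * (P\<^sup>T * P)" unfolding MP using P PT by (simp add: assoc)
    then show "M * P = P * mat_diag n d" unfolding PP using P by (simp add: assoc)
    have "P\<^sup>T * M = (P\<^sup>T * P) * mat_diag n d * P\<^sup>T" unfolding MP using P PT by (simp add: assoc)
    then show "P\<^sup>T * M = mat_diag n d * P\<^sup>T" unfolding PP using P by (simp add: assoc)
  qed
  define f where "f v i = (P\<^sup>T *\<^sub>v v) $ i" for v i
  \<comment> \<open>Parseval's identity, from \<open>P * P\<^sup>T = 1\<^sub>m n\<close>.\<close>
  have ip: "u \<bullet> v = (\<Sum>i<n. f u i * f v i)" if "u \<in> carrier_vec n" "v \<in> carrier_vec n" for u v
  proof -
    have "u \<bullet> v = u \<bullet> (P *\<^sub>v (P\<^sup>T *\<^sub>v v))"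
      using that P PT by (simp flip: assoc_mult_mat_vec[OF P PT] add: PP)
    also have "\<dots> = (P\<^sup>T *\<^sub>v u) \<bullet> (P\<^sup>T *\<^sub>v v)"
      by (rule transpose_vec_mult_scalar[symmetric]) (use that P PT in auto)
    also have "\<dots> = (\<Sum>i<n. f u i * f v i)"
      using P by (auto simp: scalar_prod_def f_def lessThan_atLeast0 intro!: sum.cong)
    finally show ?thesis .
  qed
  have fM: "f (M *\<^sub>v v) i = d i * f v i" if "v \<in> carrier_vec n" "i < n" for v i
  proof -
    have "P\<^sup>T *\<^sub>v (M *\<^sub>v v) = mat_diag n d *\<^sub>v (P\<^sup>T *\<^sub>v v)"
      using that P PT M
      by (simp flip: assoc_mult_mat_vec[of _ n n _ n] add: M2 del: assoc_mult_mat_vec)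
    moreover have "(mat_diag n d *\<^sub>v w) $ i = d i * w $ i" if w: "w \<in> carrier_vec n" for w
    proof -
      have "(mat_diag n d *\<^sub>v w) $ i = (\<Sum>j = 0..<n. (if i = j then d j else 0) * w $ j)"
        using w \<open>i < n\<close> by (simp add: mat_diag_def scalar_prod_def)
      also have "\<dots> = (\<Sum>j = 0..<n. if j = i then d i * w $ i else 0)"
        by (intro sum.cong) auto
      finally show ?thesis using \<open>i < n\<close> by simp
    qed
    ultimately show ?thesis using that PT unfolding f_def by simp
  qed
  show ?thesis
  proof (intro exI[of _ d] exI[of _ f] conjI allI ballI impI)
    fix i assume i: "i < n"
    have "M *\<^sub>v col P i = col (P * mat_diag n d) i"
      unfolding M1[symmetric] by (rule col_mult2[OF M P i, symmetric])
    also have "\<dots> = d i \<cdot>\<^sub>v col P i"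
      using P i by (intro eq_vecI) (auto simp: mat_diag_mult_right[OF P])
    finally have "M *\<^sub>v col P i = d i \<cdot>\<^sub>v col P i" .
    moreover have "col P i \<noteq> 0\<^sub>v n"
    proof
      assume "col P i = 0\<^sub>v n"
      then have "(P\<^sup>T * P) $$ (i, i) = 0" using P i by simp
      then show False using i by (simp add: PP)
    qed
    moreover have "col P i \<in> carrier_vec n" using P i by auto
    ultimately show "eigenvalue M (d i)" using M i by (auto simp: eigenvalue_def eigenvector_def)
  next
    fix v :: "real vec" assume v: "v \<in> carrier_vec n"
    then have Mv: "M *\<^sub>v v \<in> carrier_vec n" using M by simp
    show "v \<bullet> (M *\<^sub>v v) = (\<Sum>i<n. d i * (f v i)\<^sup>2)"
      using ip[OF v Mv] by (simp add: power2_eq_square fM[OF v] ac_simps)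
    show "(M *\<^sub>v v) \<bullet> (M *\<^sub>v v) = (\<Sum>i<n. (d i)\<^sup>2 * (f v i)\<^sup>2)"
      using ip[OF Mv Mv] by (simp add: power2_eq_square fM[OF v] ac_simps)
  qed
qed

lemma finite_eigenvalues:
  fixes M :: "real mat"
  assumes "M \<in> carrier_mat n n"
  shows "finite {k. eigenvalue M k}"
  using card_finite_spectrum(1)[OF assms] by (simp add: spectrum_def)

lemma scalar_prod_gram:
  fixes A :: "real mat"
  assumes A: "A \<in> carrier_mat n d" and v: "v \<in> carrier_vec d"
  shows "v \<bullet> ((A\<^sup>T * A) *\<^sub>v v) = (A *\<^sub>v v) \<bullet> (A *\<^sub>v v)"
proof -
  have AT: "A\<^sup>T \<in> carrier_mat d n" using A by simp
  have "v \<bullet> ((A\<^sup>T * A) *\<^sub>v v) = (A\<^sup>T *\<^sub>v (A *\<^sub>v v)) \<bullet> v"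
    using A v AT by (simp add: comm_scalar_prod[of v d])
  also have "\<dots> = (A *\<^sub>v v) \<bullet> (A *\<^sub>v v)"
    by (rule transpose_vec_mult_scalar) (use A v in auto)
  finally show ?thesis .
qed

subsection \<open>Extreme singular values\<close>

text \<open>For an eigenvector \<open>v\<close>, the squared norm of \<open>A *\<^sub>v v\<close> is
  \<open>k * (v \<bullet> v)\<close>. So \<open>k\<close> is positive and \<open>sqrt k\<close>
  competes in the minimum.\<close>

lemma sigma_min_sq_le_gram_eigenvalue:
  fixes A :: "real mat"
  assumes A: "A \<in> carrier_mat n d" and k: "eigenvalue (A\<^sup>T * A) k" and k0: "k \<noteq> 0"
  shows "0 < k" "(sigma_min A)\<^sup>2 \<le> k"
proof -
  have M: "A\<^sup>T * A \<in> carrier_mat d d" using A by auto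
  obtain v where v: "v \<in> carrier_vec d" "v \<noteq> 0\<^sub>v d" and Mv: "(A\<^sup>T * A) *\<^sub>v v = k \<cdot>\<^sub>v v"
    using k M by (auto simp: eigenvalue_def eigenvector_def)
  have "(A *\<^sub>v v) \<bullet> (A *\<^sub>v v) = k * (v \<bullet> v)"
    using scalar_prod_gram[OF A v(1)] v unfolding Mv by simp
  moreover have "v \<bullet> v > 0"
    using scalar_prod_self_nonneg[of v] scalar_prod_self_eq_0_iff[OF v(1)] v(2) by linarith
  ultimately have "k \<ge> 0"
    using scalar_prod_self_nonneg[of "A *\<^sub>v v"] by (simp add: zero_le_mult_iff)
  then show "0 < k" using k0 by simp
  let ?S = "singular_values A - {0}"
  have "singular_values A \<subseteq> sqrt ` {k. eigenvalue (A\<^sup>T * A) k}"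
    unfolding singular_values_def by (auto intro!: image_eqI[of _ sqrt "_\<^sup>2"])
  then have fin: "finite ?S"
    using finite_eigenvalues[OF M] by (meson finite_Diff finite_imageI finite_subset)
  have mem: "sqrt k \<in> ?S" using k \<open>0 < k\<close> by (simp add: singular_values_def)
  \<comment> \<open>The minimum is attained, so it is itself a singular value and nonnegative; this
    permits squaring the inequality.\<close>
  have "sigma_min A \<in> ?S" unfolding sigma_min_def using fin mem by (intro Min_in) auto
  then have "0 \<le> sigma_min A" by (simp add: singular_values_def)
  moreover have "sigma_min A \<le> sqrt k" unfolding sigma_min_def using fin mem by (rule Min_le)
  ultimately show "(sigma_min A)\<^sup>2 \<le> k"
    using \<open>0 < k\<close> by (metis power_mono real_sqrt_pow2 less_imp_le)
qed

text \<open>In eigencoordinates of the Gram matrix the terms are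
  \<open>(sigma_min A)\<^sup>2 * k i\<close> against \<open>(k i)\<^sup>2\<close>. Zero eigenvalues
  add nothing to either side because \<open>y\<close> lies in the range of \<open>A\<close>.\<close>

lemma sigma_min_range_bound:
  fixes A :: "real mat"
  assumes A: "A \<in> carrier_mat n d" and u: "u \<in> carrier_vec d"
  defines "y \<equiv> A *\<^sub>v u"
  shows "(sigma_min A)\<^sup>2 * (y \<bullet> y) \<le> (A\<^sup>T *\<^sub>v y) \<bullet> (A\<^sup>T *\<^sub>v y)"
proof -
  let ?M = "A\<^sup>T * A"
  have AT: "A\<^sup>T \<in> carrier_mat d n" using A by simp
  have M: "?M \<in> carrier_mat d d" using A by auto
  have sym: "?M\<^sup>T = ?M" using A by (simp add: transpose_mult[of _ d n])
  obtain k f where k: "\<And>i. i < d \<Longrightarrow> eigenvalue ?M (k i)"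
    and f: "\<And>v. v \<in> carrier_vec d \<Longrightarrow> v \<bullet> (?M *\<^sub>v v) = (\<Sum>i<d. k i * (f v i)\<^sup>2)"
      "\<And>v. v \<in> carrier_vec d \<Longrightarrow> (?M *\<^sub>v v) \<bullet> (?M *\<^sub>v v) = (\<Sum>i<d. (k i)\<^sup>2 * (f v i)\<^sup>2)"
    using real_spectral_sums[OF M sym] by blast
  have "(sigma_min A)\<^sup>2 * k i \<le> (k i)\<^sup>2" if "i < d" for i
    using sigma_min_sq_le_gram_eigenvalue[OF A k[OF that]]
    by (cases "k i = 0") (auto simp: power2_eq_square[of "k i"])
  then have "(sigma_min A)\<^sup>2 * (u \<bullet> (?M *\<^sub>v u)) \<le> (?M *\<^sub>v u) \<bullet> (?M *\<^sub>v u)"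
    unfolding f[OF u] sum_distrib_left mult.assoc[symmetric]
    by (intro sum_mono mult_right_mono) auto
  moreover have "?M *\<^sub>v u = A\<^sup>T *\<^sub>v y" using A AT u by (simp add: y_def)
  ultimately show ?thesis using scalar_prod_gram[OF A u] by (simp add: y_def)
qed

text \<open>The same comparison from above: \<open>k i\<close> is at most \<open>lambda_max\<close>
  and nonnegative, so it may be multiplied by itself.\<close>

lemma lambda_max_range_bound:
  fixes A :: "real mat"
  assumes A: "A \<in> carrier_mat n d" and u: "u \<in> carrier_vec d"
  defines "y \<equiv> A *\<^sub>v u"
  shows "(A\<^sup>T *\<^sub>v y) \<bullet> (A\<^sup>T *\<^sub>v y) \<le> lambda_max (A\<^sup>T * A) * (y \<bullet> y)"
proof -
  let ?M = "A\<^sup>T * A"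
  have AT: "A\<^sup>T \<in> carrier_mat d n" using A by simp
  have M: "?M \<in> carrier_mat d d" using A by auto
  have sym: "?M\<^sup>T = ?M" using A by (simp add: transpose_mult[of _ d n])
  obtain k f where k: "\<And>i. i < d \<Longrightarrow> eigenvalue ?M (k i)"
    and f: "\<And>v. v \<in> carrier_vec d \<Longrightarrow> v \<bullet> (?M *\<^sub>v v) = (\<Sum>i<d. k i * (f v i)\<^sup>2)"
      "\<And>v. v \<in> carrier_vec d \<Longrightarrow> (?M *\<^sub>v v) \<bullet> (?M *\<^sub>v v) = (\<Sum>i<d. (k i)\<^sup>2 * (f v i)\<^sup>2)"
    using real_spectral_sums[OF M sym] by blast
  have "(k i)\<^sup>2 \<le> lambda_max ?M * k i" if "i < d" for i
  proof -
    have "k i \<le> lambda_max ?M"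
      unfolding lambda_max_def using k[OF that] finite_eigenvalues[OF M] by (intro Max_ge) auto
    moreover have "0 \<le> k i" using sigma_min_sq_le_gram_eigenvalue(1)[OF A k[OF that]] by force
    ultimately show ?thesis by (simp add: power2_eq_square mult_right_mono)
  qed
  then have "(?M *\<^sub>v u) \<bullet> (?M *\<^sub>v u) \<le> lambda_max ?M * (u \<bullet> (?M *\<^sub>v u))"
    unfolding f[OF u] sum_distrib_left mult.assoc[symmetric]
    by (intro sum_mono mult_right_mono) auto
  moreover have "?M *\<^sub>v u = A\<^sup>T *\<^sub>v y" using A AT u by (simp add: y_def)
  ultimately show ?thesis using scalar_prod_gram[OF A u] by (simp add: y_def)
qed

subsection \<open>The Moore-Penrose pseudoinverse\<close>

text \<open>The Gram matrix and \<open>A\<close> have the same kernel, since the quadratic form of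
  the former at \<open>x\<close> is the squared norm of \<open>A *\<^sub>v x\<close>; applied to
  each column of \<open>X\<close>.\<close>

lemma gram_mult_eq_0:
  fixes A X :: "real mat"
  assumes A: "A \<in> carrier_mat n d" and X: "X \<in> carrier_mat d k"
    and 0: "A\<^sup>T * A * X = 0\<^sub>m d k"
  shows "A * X = 0\<^sub>m n k"
proof (rule eq_matI)
  fix i j assume "i < dim_row (0\<^sub>m n k)" "j < dim_col (0\<^sub>m n k)"
  then have ij: "i < n" "j < k" by auto
  have x: "col X j \<in> carrier_vec d" using X ij by auto
  have "(A\<^sup>T * A) *\<^sub>v col X j = col (A\<^sup>T * A * X) j"
    by (rule col_mult2[OF _ X ij(2), symmetric]) (use A in auto)
  also have "\<dots> = 0\<^sub>v d" unfolding 0 using ij by simp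
  finally have "(A *\<^sub>v col X j) \<bullet> (A *\<^sub>v col X j) = 0"
    using scalar_prod_gram[OF A x] x by simp
  then have "A *\<^sub>v col X j = 0\<^sub>v n"
    using scalar_prod_self_eq_0_iff[of "A *\<^sub>v col X j" n] A x by simp
  then have "(A *\<^sub>v col X j) $ i = 0" using ij by simp
  then show "(A * X) $$ (i, j) = 0\<^sub>m n k $$ (i, j)" using A X ij by simp
qed (use A X in auto)

text \<open>Keep the eigenbasis and invert the nonzero eigenvalues.\<close>

lemma real_symmetric_pseudoinverse:
  fixes M :: "real mat"
  assumes M: "M \<in> carrier_mat n n" and sym: "M\<^sup>T = M"
  obtains G where "G \<in> carrier_mat n n" "M * G * M = M" "G * M * G = G" "G\<^sup>T = G" "M * G = G * M"
proof -
  obtain P d where P: "P \<in> carrier_mat n n" and PP: "P\<^sup>T * P = 1\<^sub>m n"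
    and MP: "M = P * mat_diag n d * P\<^sup>T" using real_spectral_decomposition[OF M sym] by blast
  have PT: "P\<^sup>T \<in> carrier_mat n n" using P by simp
  note assoc = assoc_mult_mat[of _ n n _ n _ n] mult_carrier_mat[of _ n n _ n]
    left_mult_one_mat[of _ n n] right_mult_one_mat[of _ n n]
  \<comment> \<open>Functional calculus: products of such matrices become pointwise products of
    functions on the indices.\<close>
  define F where "F g = P * mat_diag n g * P\<^sup>T" for g
  have Fc: "F g \<in> carrier_mat n n" for g using P unfolding F_def by auto
  have FF: "F g * F h = F (\<lambda>i. g i * h i)" for g h
  proof -
    have "F g * F h = P * mat_diag n g * (P\<^sup>T * P) * mat_diag n h * P\<^sup>T"
      unfolding F_def using P PT by (simp add: assoc)
    also have "\<dots> = P * (mat_diag n g * mat_diag n h) * P\<^sup>T"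
      unfolding PP using P PT by (simp add: assoc del: mat_diag_diag)
    finally show ?thesis by (simp add: F_def)
  qed
  have FT: "(F g)\<^sup>T = F g" for g
  proof -
    have "(mat_diag n g)\<^sup>T = mat_diag n g" by (rule eq_matI) (auto simp: mat_diag_def)
    then show ?thesis
      unfolding F_def using P PT by (simp add: transpose_mult[of _ n n _ n] assoc)
  qed
  have MF: "M = F d" by (simp add: F_def MP)
  show thesis
  proof (rule that[of "F (\<lambda>i. inverse (d i))"])
    \<comment> \<open>Both identities survive at zero eigenvalues because
      \<open>inverse 0 = 0\<close>.\<close>
    have "(\<lambda>i. d i * inverse (d i) * d i) = d" "(\<lambda>i. inverse (d i) * d i * inverse (d i)) = (\<lambda>i. inverse (d i))"
      by (simp_all add: fun_eq_iff field_simps)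
    then show "M * F (\<lambda>i. inverse (d i)) * M = M"
      "F (\<lambda>i. inverse (d i)) * M * F (\<lambda>i. inverse (d i)) = F (\<lambda>i. inverse (d i))"
      unfolding MF FF by simp_all
    show "M * F (\<lambda>i. inverse (d i)) = F (\<lambda>i. inverse (d i)) * M"
      unfolding MF FF by (simp add: mult.commute)
  qed (simp_all add: Fc FT)
qed

text \<open>The condition under \<open>THE\<close> in \<open>pinv\<close>, isolated so that
  existence and uniqueness can be proved separately.\<close>

definition penrose :: "real mat \<Rightarrow> real mat \<Rightarrow> bool" where
  "penrose A X \<longleftrightarrow> X \<in> carrier_mat (dim_col A) (dim_row A) \<and>
     A * X * A = A \<and> X * A * X = X \<and> (A * X)\<^sup>T = A * X \<and> (X * A)\<^sup>T = X * A"

text \<open>The witness is \<open>G * A\<^sup>T\<close>, with \<open>G\<close> the pseudoinverse of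
  the symmetric Gram matrix.\<close>

lemma penrose_exists:
  fixes A :: "real mat"
  shows "\<exists>X. penrose A X"
proof -
  define n d where "n = dim_row A" and "d = dim_col A"
  have A: "A \<in> carrier_mat n d" and AT: "A\<^sup>T \<in> carrier_mat d n" by (auto simp: n_def d_def)
  let ?M = "A\<^sup>T * A"
  have M: "?M \<in> carrier_mat d d" using A by auto
  have sym: "?M\<^sup>T = ?M" using A by (simp add: transpose_mult[of _ d n])
  obtain G where G: "G \<in> carrier_mat d d" and G1: "?M * G * ?M = ?M" and G2: "G * ?M * G = G"
    and GT: "G\<^sup>T = G" and comm: "?M * G = G * ?M"
    using real_symmetric_pseudoinverse[OF M sym] .
  have GM: "G * ?M \<in> carrier_mat d d" using G M by auto
  \<comment> \<open>Cancelling \<open>A\<^sup>T\<close> from this vanishing product by the kernel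
    lemma gives \<open>A * (G * ?M) = A\<close>.\<close>
  have "?M * (G * ?M - 1\<^sub>m d) = ?M * (G * ?M) - ?M * 1\<^sub>m d"
    by (rule mult_minus_distrib_mat[OF M GM]) simp
  also have "\<dots> = 0\<^sub>m d d"
    using G1 M by (simp add: assoc_mult_mat[OF M G M, symmetric] right_mult_one_mat[OF M] minus_r_inv_mat[OF M])
  finally have "A * (G * ?M - 1\<^sub>m d) = 0\<^sub>m n d"
    by (intro gram_mult_eq_0[OF A]) (use GM in auto)
  then have diff0: "A * (G * ?M) - A = 0\<^sub>m n d"
    using A GM by (simp add: mult_minus_distrib_mat[OF A GM])
  have AGM: "A * (G * ?M) = A"
  proof (intro eq_matI)
    fix i j assume "i < dim_row A" "j < dim_col A"
    then show "(A * (G * ?M)) $$ (i, j) = A $$ (i, j)"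
      using arg_cong[OF diff0, of "\<lambda>Z. Z $$ (i, j)"] A GM by (simp del: index_mult_mat(1))
  qed (use A GM in auto)
  define X where "X = G * A\<^sup>T"
  have X: "X \<in> carrier_mat d n" using G AT unfolding X_def by auto
  have XA: "X * A = G * ?M" unfolding X_def using G A AT by (simp add: assoc_mult_mat[of _ d d _ n _ d])
  have "penrose A X"
    unfolding penrose_def
  proof (intro conjI)
    show "X \<in> carrier_mat (dim_col A) (dim_row A)" using X by (simp add: n_def d_def)
    show "A * X * A = A" using AGM A X by (simp add: XA assoc_mult_mat[of _ n d _ n _ d])
    show "X * A * X = X"
    proof -
      have "X * A * X = G * ?M * G * A\<^sup>T" unfolding XA unfolding X_def using G M AT GM
        by (simp add: assoc_mult_mat[of _ d d _ d _ n])
      then show ?thesis by (simp add: G2 X_def)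
    qed
    show "(A * X)\<^sup>T = A * X" unfolding X_def using A G AT GT
      by (simp add: transpose_mult[of _ n d _ n] transpose_mult[of _ d d _ n] assoc_mult_mat[of _ n d _ d _ n])
    \<comment> \<open>A product of two commuting symmetric matrices is symmetric.\<close>
    show "(X * A)\<^sup>T = X * A" unfolding XA using G M sym GT comm
      by (simp add: transpose_mult[of _ d d _ d])
  qed
  then show ?thesis ..
qed

text \<open>Transposing products of the symmetric projections gives \<open>A * X = A * Y\<close> and
  \<open>X * A = Y * A\<close>; then \<open>X = X * A * Y = Y * A * Y = Y\<close>.\<close>

lemma penrose_unique:
  assumes X: "penrose A X" and Y: "penrose A Y"
  shows "X = Y"
proof -
  define n d where "n = dim_row A" and "d = dim_col A"
  have A: "A \<in> carrier_mat n d" by (auto simp: n_def d_def)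
  have Xc: "X \<in> carrier_mat d n" and X1: "A * X * A = A" "X * A * X = X"
    and X2: "(A * X)\<^sup>T = A * X" "(X * A)\<^sup>T = X * A"
    using X by (auto simp: penrose_def n_def d_def)
  have Yc: "Y \<in> carrier_mat d n" and Y1: "A * Y * A = A" "Y * A * Y = Y"
    and Y2: "(A * Y)\<^sup>T = A * Y" "(Y * A)\<^sup>T = Y * A"
    using Y by (auto simp: penrose_def n_def d_def)
  have AX: "A * X \<in> carrier_mat n n" and AY: "A * Y \<in> carrier_mat n n"
    and XA: "X * A \<in> carrier_mat d d" and YA: "Y * A \<in> carrier_mat d d" using A Xc Yc by auto
  have "A * X = A * Y * (A * X)" using assoc_mult_mat[OF AY A Xc, unfolded Y1(1)] .
  also have "\<dots> = (A * X * (A * Y))\<^sup>T" using transpose_mult[OF AX AY] X2 Y2 by simp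
  also have "A * X * (A * Y) = A * Y" using assoc_mult_mat[OF AX A Yc, unfolded X1(1)] ..
  finally have 1: "A * X = A * Y" unfolding Y2 .
  have "X * A = X * A * (Y * A)"
    by (simp only: assoc_mult_mat[OF Xc A YA] assoc_mult_mat[OF A Yc A, symmetric] Y1(1))
  also have "\<dots> = (Y * A * (X * A))\<^sup>T" using transpose_mult[OF YA XA] X2 Y2 by simp
  also have "Y * A * (X * A) = Y * A"
    by (simp only: assoc_mult_mat[OF Yc A XA] assoc_mult_mat[OF A Xc A, symmetric] X1(1))
  finally have 2: "X * A = Y * A" unfolding Y2 .
  have "X = X * (A * Y)" by (simp only: 1[symmetric] assoc_mult_mat[OF Xc A Xc, symmetric] X1(2))
  also have "\<dots> = Y * A * Y" by (simp only: 2[symmetric] assoc_mult_mat[OF Xc A Yc])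
  finally show ?thesis using Y1(2) by simp
qed

lemma penrose_pinv: "penrose A (pinv A)"
proof -
  have "\<exists>!X. penrose A X" using penrose_exists penrose_unique by blast
  then have "penrose A (THE X. penrose A X)" by (rule theI')
  then show ?thesis unfolding pinv_def penrose_def .
qed

lemma pinv_carrier:
  assumes "A \<in> carrier_mat n d"
  shows "pinv A \<in> carrier_mat d n"
  using penrose_pinv[of A] assms by (simp add: penrose_def)

section \<open>The orthogonal projection \<open>B * pinv B\<close>\<close>

text \<open>The normal equations, obtained by transposing \<open>B * pinv B * B = B\<close> and
  using the symmetry of \<open>B * pinv B\<close>.\<close>

lemma transpose_mult_pinv_proj:
  assumes B: "B \<in> carrier_mat n m" and z: "z \<in> carrier_vec n"
  shows "B\<^sup>T *\<^sub>v (B *\<^sub>v (pinv B *\<^sub>v z)) = B\<^sup>T *\<^sub>v z"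
proof -
  have X: "pinv B \<in> carrier_mat m n" using pinv_carrier[OF B] .
  have BT: "B\<^sup>T \<in> carrier_mat m n" and BX: "B * pinv B \<in> carrier_mat n n" using B X by auto
  have "B\<^sup>T = (B * pinv B * B)\<^sup>T" using penrose_pinv[of B] by (simp add: penrose_def)
  also have "\<dots> = B\<^sup>T * (B * pinv B)"
    using transpose_mult[OF BX B] penrose_pinv[of B] by (simp add: penrose_def)
  finally have *: "B\<^sup>T = B\<^sup>T * (B * pinv B)" .
  have "B\<^sup>T *\<^sub>v z = (B\<^sup>T * (B * pinv B)) *\<^sub>v z" using * by simp
  also have "\<dots> = B\<^sup>T *\<^sub>v (B *\<^sub>v (pinv B *\<^sub>v z))"
    using assoc_mult_mat_vec[OF BT BX z] assoc_mult_mat_vec[OF B X z] by simp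
  finally show ?thesis ..
qed

text \<open>The projection kills what is orthogonal to the range: by the normal equations its
  squared norm equals \<open>(B\<^sup>T *\<^sub>v z) \<bullet> w\<close>.\<close>

lemma pinv_proj_eq_0:
  assumes B: "B \<in> carrier_mat n m" and z: "z \<in> carrier_vec n" and 0: "B\<^sup>T *\<^sub>v z = 0\<^sub>v m"
  shows "B *\<^sub>v (pinv B *\<^sub>v z) = 0\<^sub>v n"
proof -
  define w where "w = pinv B *\<^sub>v z"
  have w: "w \<in> carrier_vec m" using pinv_carrier[OF B] z by (simp add: w_def)
  have "(B *\<^sub>v w) \<bullet> (B *\<^sub>v w) = (B\<^sup>T *\<^sub>v (B *\<^sub>v w)) \<bullet> w"
    by (rule transpose_vec_mult_scalar[symmetric]) (use B w in auto)
  also have "\<dots> = 0" using transpose_mult_pinv_proj[OF B z] 0 w by (simp add: w_def)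
  finally show ?thesis using scalar_prod_self_eq_0_iff[of "B *\<^sub>v w" n] B w by (simp add: w_def)
qed

text \<open>The normal equations give \<open>z \<bullet> q = q \<bullet> q\<close>, so the cross
  terms collapse.\<close>

lemma pinv_proj_pythagoras:
  assumes B: "B \<in> carrier_mat n m" and z: "z \<in> carrier_vec n"
  defines "q \<equiv> B *\<^sub>v (pinv B *\<^sub>v z)"
  shows "(z - q) \<bullet> (z - q) = z \<bullet> z - q \<bullet> q"
proof -
  define w where "w = pinv B *\<^sub>v z"
  have w: "w \<in> carrier_vec m" using pinv_carrier[OF B] z by (simp add: w_def)
  have qw: "q = B *\<^sub>v w" by (simp add: q_def w_def)
  have q: "q \<in> carrier_vec n" using B w by (simp add: qw)
  have "z \<bullet> q = (B\<^sup>T *\<^sub>v z) \<bullet> w"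
    unfolding qw by (rule transpose_vec_mult_scalar[symmetric]) (use B w z in auto)
  also have "\<dots> = (B\<^sup>T *\<^sub>v q) \<bullet> w" using transpose_mult_pinv_proj[OF B z] by (simp add: q_def)
  also have "\<dots> = q \<bullet> q"
    unfolding qw by (rule transpose_vec_mult_scalar) (use B w in auto)
  finally have "z \<bullet> q = q \<bullet> q" .
  then show ?thesis using z q comm_scalar_prod[OF z q]
    by (simp add: minus_scalar_prod_distrib[of _ n] scalar_prod_minus_distrib[of _ n])
qed

subsection \<open>Column blocks\<close>

context
  fixes \<tau> :: "nat set" and d :: nat
  assumes \<tau>: "\<tau> \<subseteq> {0..<d}"
begin

lemma block_finite: "finite \<tau>"
  using \<tau> finite_subset by blast

lemma col_submatrix_carrier:
  assumes "A \<in> carrier_mat n d"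
  shows "col_submatrix A \<tau> \<in> carrier_mat n (card \<tau>)"
proof -
  have "{j. j < d \<and> j \<in> \<tau>} = \<tau>" using \<tau> by auto
  then have "card {j. j < dim_col A \<and> j \<in> \<tau>} = card \<tau>"
    unfolding carrier_matD(2)[OF assms] by (rule arg_cong)
  then have "dim_col (col_submatrix A \<tau>) = card \<tau>"
    unfolding col_submatrix_def dim_submatrix .
  moreover have "dim_row (col_submatrix A \<tau>) = n"
    unfolding col_submatrix_def dim_submatrix using assms by simp
  ultimately show ?thesis by blast
qed

text \<open>Translates between positions inside a block and original column indices.
  \<open>pick\<close> is a left inverse, and equal cardinalities give surjectivity.\<close>

lemma bij_betw_block_rank: "bij_betw (\<lambda>i. card {j \<in> \<tau>. j < i}) \<tau> {0..<card \<tau>}"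
proof -
  have inj: "inj_on (\<lambda>i. card {j \<in> \<tau>. j < i}) \<tau>"
    by (rule inj_on_inverseI[where g = "pick \<tau>"]) (rule pick_card_in_set)
  moreover have "(\<lambda>i. card {j \<in> \<tau>. j < i}) ` \<tau> = {0..<card \<tau>}"
  proof (rule card_subset_eq)
    show "(\<lambda>i. card {j \<in> \<tau>. j < i}) ` \<tau> \<subseteq> {0..<card \<tau>}"
      using block_finite by (auto intro!: psubset_card_mono)
  qed (simp_all add: card_image[OF inj])
  ultimately show ?thesis by (simp add: bij_betw_def)
qed

lemma sum_block_rank: "(\<Sum>k = 0..<card \<tau>. g k) = (\<Sum>i\<in>\<tau>. g (card {j \<in> \<tau>. j < i}))"
  using sum.reindex_bij_betw[OF bij_betw_block_rank, of g] by simp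

lemma col_submatrix_index:
  assumes A: "A \<in> carrier_mat n d" and "r < n" "i \<in> \<tau>"
  shows "col_submatrix A \<tau> $$ (r, card {j \<in> \<tau>. j < i}) = A $$ (r, i)"
proof -
  \<comment> \<open>All rows are kept, so the rank of row \<open>r\<close> is \<open>r\<close>
    itself.\<close>
  have "{a \<in> UNIV. a < r} = {..<r}" by auto
  then show ?thesis
    using submatrix_index_card[of r A i UNIV \<tau>] assms \<tau> by (auto simp: col_submatrix_def)
qed

lemma col_col_submatrix:
  assumes A: "A \<in> carrier_mat n d" and i: "i \<in> \<tau>"
  shows "col (col_submatrix A \<tau>) (card {j \<in> \<tau>. j < i}) = col A i"
proof -
  have "card {j \<in> \<tau>. j < i} < card \<tau>" "i < d"
    using bij_betw_apply[OF bij_betw_block_rank i] i \<tau> by auto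
  then show ?thesis
    using A col_submatrix_carrier[OF A] col_submatrix_index[OF A _ i] by (intro eq_vecI) auto
qed

lemma col_submatrix_transpose_norm:
  assumes A: "A \<in> carrier_mat n d"
  shows "((col_submatrix A \<tau>)\<^sup>T *\<^sub>v y) \<bullet> ((col_submatrix A \<tau>)\<^sup>T *\<^sub>v y) = (\<Sum>i\<in>\<tau>. (col A i \<bullet> y)\<^sup>2)"
proof -
  have "((col_submatrix A \<tau>)\<^sup>T *\<^sub>v y) \<bullet> ((col_submatrix A \<tau>)\<^sup>T *\<^sub>v y)
    = (\<Sum>k = 0..<card \<tau>. (col (col_submatrix A \<tau>) k \<bullet> y)\<^sup>2)"
    using col_submatrix_carrier[OF A] by (auto simp: scalar_prod_def[of "_ *\<^sub>v _"] power2_eq_square)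
  also have "\<dots> = (\<Sum>i\<in>\<tau>. (col A i \<bullet> y)\<^sup>2)"
    unfolding sum_block_rank by (simp add: col_col_submatrix[OF A])
  finally show ?thesis .
qed

text \<open>Links the update of \<open>x\<close> with that of \<open>z\<close>: in each row the
  added terms form a sum over the block, reindexed by rank.\<close>

lemma mult_add_on_block:
  assumes A: "A \<in> carrier_mat n d" and x: "x \<in> carrier_vec d" and w: "w \<in> carrier_vec (card \<tau>)"
  shows "A *\<^sub>v add_on_block x \<tau> w = A *\<^sub>v x + col_submatrix A \<tau> *\<^sub>v w"
proof (rule eq_vecI)
  let ?B = "col_submatrix A \<tau>" and ?r = "\<lambda>i. card {j \<in> \<tau>. j < i}"
  note B = col_submatrix_carrier[OF A]
  fix r assume "r < dim_vec (A *\<^sub>v x + ?B *\<^sub>v w)"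
  then have r: "r < n" using B by simp
  have "(A *\<^sub>v add_on_block x \<tau> w) $ r =
    (\<Sum>i = 0..<d. A $$ (r, i) * (if i \<in> \<tau> then x $ i + w $ ?r i else x $ i))"
    using A x r by (simp add: scalar_prod_def add_on_block_def)
  also have "\<dots> = (\<Sum>i = 0..<d. A $$ (r, i) * x $ i + (if i \<in> \<tau> then A $$ (r, i) * w $ ?r i else 0))"
    by (intro sum.cong) (auto simp: distrib_left)
  also have "\<dots> = (A *\<^sub>v x) $ r + (\<Sum>i\<in>\<tau>. A $$ (r, i) * w $ ?r i)"
    using A x r \<tau> by (simp add: sum.distrib scalar_prod_def sum.If_cases Int_absorb1)
  also have "(\<Sum>i\<in>\<tau>. A $$ (r, i) * w $ ?r i) = (?B *\<^sub>v w) $ r"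
    using B w r col_submatrix_index[OF A r] by (simp add: scalar_prod_def sum_block_rank)
  finally show "(A *\<^sub>v add_on_block x \<tau> w) $ r = (A *\<^sub>v x + ?B *\<^sub>v w) $ r"
    using A B r by simp
qed (use A col_submatrix_carrier[OF A] in simp)

end

text \<open>Both sides sum \<open>(col A i \<bullet> y)\<^sup>2\<close> over all columns; the
  partition merely groups the terms.\<close>

lemma sum_block_norms:
  assumes A: "A \<in> carrier_mat n d" and part: "partition_on {0..<d} \<T>"
  shows "(\<Sum>\<tau>\<in>\<T>. ((col_submatrix A \<tau>)\<^sup>T *\<^sub>v y) \<bullet> ((col_submatrix A \<tau>)\<^sup>T *\<^sub>v y))
    = (A\<^sup>T *\<^sub>v y) \<bullet> (A\<^sup>T *\<^sub>v y)"
proof -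
  have U: "{0..<d} = \<Union>\<T>" and dis: "disjoint \<T>" using part by (auto dest: partition_onD1 partition_onD2)
  have sub: "\<tau> \<subseteq> {0..<d}" if "\<tau> \<in> \<T>" for \<tau> using that U by auto
  have "(\<Sum>\<tau>\<in>\<T>. ((col_submatrix A \<tau>)\<^sup>T *\<^sub>v y) \<bullet> ((col_submatrix A \<tau>)\<^sup>T *\<^sub>v y))
    = (\<Sum>\<tau>\<in>\<T>. \<Sum>i\<in>\<tau>. (col A i \<bullet> y)\<^sup>2)"
    using col_submatrix_transpose_norm[OF sub A] by simp
  also have "\<dots> = (\<Sum>i\<in>\<Union>\<T>. (col A i \<bullet> y)\<^sup>2)"
    using dis block_finite[OF sub] by (subst sum.Union_disjoint) (auto simp: disjoint_def)
  also have "\<dots> = (A\<^sup>T *\<^sub>v y) \<bullet> (A\<^sup>T *\<^sub>v y)"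
    using A by (auto simp: U[symmetric] scalar_prod_def[of "_ *\<^sub>v _"] power2_eq_square)
  finally show ?thesis .
qed

subsection \<open>Convergence of the solver\<close>

text \<open>Finite supports reduce the expectations to finite sums, so integrability is no
  concern.\<close>

lemma pmf_expectation_bind_finite:
  fixes h :: "'b \<Rightarrow> real"
  assumes "finite (set_pmf M)" "\<And>x. x \<in> set_pmf M \<Longrightarrow> finite (set_pmf (f x))"
  shows "measure_pmf.expectation (bind_pmf M f) h
    = measure_pmf.expectation M (\<lambda>x. measure_pmf.expectation (f x) h)"
  using assms
  by (simp add: pmf_expectation_bind[of "set_pmf M"] integral_measure_pmf[of "set_pmf M" M])

context
  fixes A :: "real mat" and b :: "real vec" and \<T> :: "nat set set" and n d p :: nat and \<alpha> \<beta> :: real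
  assumes A: "A \<in> carrier_mat n d" and A0: "A \<noteq> 0\<^sub>m n d" and b: "b \<in> carrier_vec n"
    and paving: "column_paving A \<T> p \<alpha> \<beta>"
begin

lemma paving_partition: "partition_on {0..<d} \<T>" and card_paving: "card \<T> = p"
  and lambda_max_block: "\<tau> \<in> \<T> \<Longrightarrow> lambda_max ((col_submatrix A \<tau>)\<^sup>T * col_submatrix A \<tau>) \<le> \<beta>"
  using paving A by (auto simp: column_paving_def)

lemma block_subset: "\<tau> \<in> \<T> \<Longrightarrow> \<tau> \<subseteq> {0..<d}"
  using paving_partition by (auto dest: partition_onD1)

lemma finite_paving: "finite \<T>"
  using paving_partition by (rule finite_elements[rotated]) simp

lemma block_carrier: "\<tau> \<in> \<T> \<Longrightarrow> col_submatrix A \<tau> \<in> carrier_mat n (card \<tau>)"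
  using col_submatrix_carrier[OF block_subset A] .

text \<open>The orthogonal projection \<open>P\<^sub>\<tau>\<close> onto the range of the
  block.\<close>

definition block_proj :: "nat set \<Rightarrow> real vec \<Rightarrow> real vec" where
  "block_proj \<tau> y = col_submatrix A \<tau> *\<^sub>v (pinv (col_submatrix A \<tau>) *\<^sub>v y)"

text \<open>The normal equations replace \<open>y\<close> by its projection, which lies in the range
  of the block, where the bound by \<open>lambda_max\<close> applies.\<close>

lemma block_proj_lower_bound:
  assumes \<tau>: "\<tau> \<in> \<T>" and y: "y \<in> carrier_vec n"
  shows "((col_submatrix A \<tau>)\<^sup>T *\<^sub>v y) \<bullet> ((col_submatrix A \<tau>)\<^sup>T *\<^sub>v y)
    \<le> \<beta> * (block_proj \<tau> y \<bullet> block_proj \<tau> y)"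
proof -
  let ?B = "col_submatrix A \<tau>" and ?q = "block_proj \<tau> y"
  have B: "?B \<in> carrier_mat n (card \<tau>)" using block_carrier[OF \<tau>] .
  have w: "pinv ?B *\<^sub>v y \<in> carrier_vec (card \<tau>)" using pinv_carrier[OF B] y by simp
  have "(?B\<^sup>T *\<^sub>v y) \<bullet> (?B\<^sup>T *\<^sub>v y) \<le> lambda_max (?B\<^sup>T * ?B) * (?q \<bullet> ?q)"
    using lambda_max_range_bound[OF B w] transpose_mult_pinv_proj[OF B y] by (simp add: block_proj_def)
  also have "\<dots> \<le> \<beta> * (?q \<bullet> ?q)"
    using lambda_max_block[OF \<tau>] by (intro mult_right_mono scalar_prod_self_nonneg)
  finally show ?thesis .
qed

lemma sum_block_proj_lower_bound:
  assumes y: "y \<in> carrier_vec n"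
  shows "(A\<^sup>T *\<^sub>v y) \<bullet> (A\<^sup>T *\<^sub>v y) \<le> \<beta> * (\<Sum>\<tau>\<in>\<T>. block_proj \<tau> y \<bullet> block_proj \<tau> y)"
  unfolding sum_block_norms[OF A paving_partition, symmetric] sum_distrib_left
  using block_proj_lower_bound[OF _ y] by (rule sum_mono)

lemma block_proj_pythagoras:
  assumes "\<tau> \<in> \<T>" "y \<in> carrier_vec n"
  shows "(y - block_proj \<tau> y) \<bullet> (y - block_proj \<tau> y) = y \<bullet> y - block_proj \<tau> y \<bullet> block_proj \<tau> y"
  unfolding block_proj_def using pinv_proj_pythagoras[OF block_carrier] assms .

section \<open>Signs of the constants and the one-step contraction\<close>

lemma nonzero_entry: obtains i j where "i < n" "j < d" "A $$ (i, j) \<noteq> 0"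
proof -
  have "\<exists>i<n. \<exists>j<d. A $$ (i, j) \<noteq> 0"
  proof (rule ccontr)
    assume "\<not> ?thesis"
    then have "A = 0\<^sub>m n d" using A by (intro eq_matI) auto
    then show False using A0 by contradiction
  qed
  then show thesis using that by blast
qed

text \<open>A unit vector picking a nonzero row makes the left side of
  \<open>sum_block_proj_lower_bound\<close> positive, while the factor next to
  \<open>\<beta>\<close> is nonnegative.\<close>

lemma paving_beta_pos: "\<beta> > 0"
proof -
  obtain i j where ij: "i < n" "j < d" "A $$ (i, j) \<noteq> 0" by (rule nonzero_entry)
  define y where "y = A\<^sup>T *\<^sub>v unit_vec n i"
  have y: "y \<in> carrier_vec d" using A by (simp add: y_def)
  have "y $ j = A $$ (i, j)" using A ij by (simp add: y_def)
  then have "y \<noteq> 0\<^sub>v d" using ij by auto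
  then have "0 < y \<bullet> y" using scalar_prod_self_eq_0_iff[OF y] scalar_prod_self_nonneg[of y] by linarith
  also have "\<dots> \<le> \<beta> * (\<Sum>\<tau>\<in>\<T>. block_proj \<tau> (unit_vec n i) \<bullet> block_proj \<tau> (unit_vec n i))"
    using sum_block_proj_lower_bound[of "unit_vec n i"] by (simp add: y_def)
  finally show ?thesis
    using sum_nonneg[of \<T> "\<lambda>\<tau>. block_proj \<tau> (unit_vec n i) \<bullet> block_proj \<tau> (unit_vec n i)"]
    by (simp add: zero_less_mult_iff scalar_prod_self_nonneg)
qed

lemma paving_card_pos: "p > 0"
proof -
  obtain i j where "i < n" "j < d" "A $$ (i, j) \<noteq> 0" by (rule nonzero_entry)
  then have "\<T> \<noteq> {}" using paving_partition by (auto dest: partition_onD1)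
  then show ?thesis using card_paving finite_paving by auto
qed

abbreviation (input) rbls_rate :: real where "rbls_rate \<equiv> 1 - (sigma_min A)\<^sup>2 / (real p * \<beta>)"

text \<open>One step averaged over a uniform block: Pythagoras subtracts the squared projections,
  whose sum is bounded below through \<open>\<beta>\<close> and \<open>sigma_min\<close>.\<close>

lemma mean_residual_bound:
  assumes u: "u \<in> carrier_vec d"
  defines "e \<equiv> A *\<^sub>v u"
  shows "(\<Sum>\<tau>\<in>\<T>. (e - block_proj \<tau> e) \<bullet> (e - block_proj \<tau> e)) / real p \<le> rbls_rate * (e \<bullet> e)"
proof -
  have e: "e \<in> carrier_vec n" using A u by (simp add: e_def)
  let ?S = "\<Sum>\<tau>\<in>\<T>. block_proj \<tau> e \<bullet> block_proj \<tau> e"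
  have "(sigma_min A)\<^sup>2 * (e \<bullet> e) \<le> \<beta> * ?S"
    using sigma_min_range_bound[OF A u] sum_block_proj_lower_bound[OF e] by (simp add: e_def)
  then have "(sigma_min A)\<^sup>2 * (e \<bullet> e) / (real p * \<beta>) \<le> ?S / real p"
    using paving_beta_pos paving_card_pos by (simp add: field_simps)
  moreover have "(\<Sum>\<tau>\<in>\<T>. (e - block_proj \<tau> e) \<bullet> (e - block_proj \<tau> e)) = real p * (e \<bullet> e) - ?S"
    by (simp add: block_proj_pythagoras[OF _ e] sum_subtractf card_paving)
  ultimately show ?thesis using paving_card_pos by (simp add: diff_divide_distrib left_diff_distrib)
qed

text \<open>At a nonzero column \<open>e\<close> of \<open>A\<close>, the mean residual is
  nonnegative and at most the rate times \<open>e \<bullet> e > 0\<close>.\<close>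

lemma rbls_rate_nonneg: "rbls_rate \<ge> 0"
proof -
  obtain i j where ij: "i < n" "j < d" "A $$ (i, j) \<noteq> 0" by (rule nonzero_entry)
  define e where "e = A *\<^sub>v unit_vec d j"
  have e: "e \<in> carrier_vec n" using A by (simp add: e_def)
  have "e $ i = A $$ (i, j)" using A ij by (simp add: e_def)
  then have "e \<noteq> 0\<^sub>v n" using ij by auto
  then have pos: "0 < e \<bullet> e" using scalar_prod_self_eq_0_iff[OF e] scalar_prod_self_nonneg[of e] by linarith
  have "0 \<le> (\<Sum>\<tau>\<in>\<T>. (e - block_proj \<tau> e) \<bullet> (e - block_proj \<tau> e)) / real p"
    by (intro divide_nonneg_nonneg sum_nonneg scalar_prod_self_nonneg) simp
  also have "\<dots> \<le> rbls_rate * (e \<bullet> e)"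
    using mean_residual_bound[of "unit_vec d j"] by (simp add: e_def)
  finally show ?thesis using pos by (simp add: zero_le_mult_iff)
qed

section \<open>Evolution of the error along the iterates\<close>

definition rbls_error :: "real vec \<Rightarrow> real vec" where
  "rbls_error x = A *\<^sub>v (x_LS A b - x)"

text \<open>The invariant of the iteration; it makes the error, a function of the first component
  alone, determine the step.\<close>

definition rbls_consistent :: "real vec \<times> real vec \<Rightarrow> bool" where
  "rbls_consistent s \<longleftrightarrow> fst s \<in> carrier_vec d \<and> snd s = b - A *\<^sub>v fst s"

lemma x_LS_carrier: "x_LS A b \<in> carrier_vec d"
  unfolding x_LS_def using pinv_carrier[OF A] b by simp

lemma rbls_error_eq:
  assumes "x \<in> carrier_vec d"
  shows "rbls_error x = A *\<^sub>v x_LS A b - A *\<^sub>v x"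
  unfolding rbls_error_def using A x_LS_carrier assms by (simp add: mult_minus_distrib_mat_vec)

text \<open>The solver applies the block projection to the residual \<open>b - A x\<close>, which differs from the
  error only by the component of \<open>b\<close> orthogonal to the range of \<open>A\<close>.\<close>

lemma block_proj_residual:
  assumes \<tau>: "\<tau> \<in> \<T>" and x: "x \<in> carrier_vec d"
  shows "block_proj \<tau> (b - A *\<^sub>v x) = block_proj \<tau> (rbls_error x)"
proof -
  let ?B = "col_submatrix A \<tau>"
  define r where "r = b - A *\<^sub>v x_LS A b"
  have B: "?B \<in> carrier_mat n (card \<tau>)" using block_carrier[OF \<tau>] .
  have BT: "?B\<^sup>T \<in> carrier_mat (card \<tau>) n" using B by simp
  have Bp: "pinv ?B \<in> carrier_mat (card \<tau>) n" using pinv_carrier[OF B] .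
  have r: "r \<in> carrier_vec n" using A b x_LS_carrier by (simp add: r_def)
  have e: "rbls_error x \<in> carrier_vec n" using A x x_LS_carrier by (simp add: rbls_error_def)
  have AT: "A\<^sup>T \<in> carrier_mat d n" using A by simp
  \<comment> \<open>By the normal equations for \<open>A\<close>, the least squares residual
    \<open>r\<close> is orthogonal to every column of \<open>A\<close>, hence to those of the block,
    so its block projection vanishes.\<close>
  have "A\<^sup>T *\<^sub>v r = A\<^sup>T *\<^sub>v b - A\<^sup>T *\<^sub>v (A *\<^sub>v x_LS A b)"
    unfolding r_def using A b x_LS_carrier by (intro mult_minus_distrib_mat_vec[OF AT]) auto
  also have "\<dots> = 0\<^sub>v d" using transpose_mult_pinv_proj[OF A b] AT b by (simp add: x_LS_def)
  finally have "(A\<^sup>T *\<^sub>v r) $ i = 0" if "i < d" for i using that by simp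
  then have "col A i \<bullet> r = 0" if "i < d" for i using A that by simp
  then have "(\<Sum>i\<in>\<tau>. (col A i \<bullet> r)\<^sup>2) = 0" using block_subset[OF \<tau>] by (intro sum.neutral) auto
  then have "(?B\<^sup>T *\<^sub>v r) \<bullet> (?B\<^sup>T *\<^sub>v r) = 0"
    using col_submatrix_transpose_norm[OF block_subset[OF \<tau>] A] by simp
  then have "?B\<^sup>T *\<^sub>v r = 0\<^sub>v (card \<tau>)"
    using scalar_prod_self_eq_0_iff[of "?B\<^sup>T *\<^sub>v r"] BT r by simp
  then have 0: "?B *\<^sub>v (pinv ?B *\<^sub>v r) = 0\<^sub>v n" by (rule pinv_proj_eq_0[OF B r])
  have "b - A *\<^sub>v x = rbls_error x + r"
    using A b x x_LS_carrier by (intro eq_vecI) (auto simp: rbls_error_eq[OF x] r_def)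
  then have "block_proj \<tau> (b - A *\<^sub>v x) = block_proj \<tau> (rbls_error x) + ?B *\<^sub>v (pinv ?B *\<^sub>v r)"
    unfolding block_proj_def using B Bp r e
    by (simp add: mult_add_distrib_mat_vec[OF Bp e r] mult_add_distrib_mat_vec[of ?B n "card \<tau>"])
  then show ?thesis using B Bp e by (simp add: 0 block_proj_def)
qed

text \<open>The update adds \<open>?B *\<^sub>v w\<close> to \<open>A *\<^sub>v x\<close>, so
  residual and error lose this same vector, which by \<open>block_proj_residual\<close> is the
  projected error.\<close>

lemma rbls_step_consistent:
  assumes \<tau>: "\<tau> \<in> \<T>" and s: "rbls_consistent s"
  shows "rbls_consistent (rbls_step A \<tau> s)"
    and "rbls_error (fst (rbls_step A \<tau> s)) = rbls_error (fst s) - block_proj \<tau> (rbls_error (fst s))"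
proof -
  let ?B = "col_submatrix A \<tau>"
  obtain x z where sxz: "s = (x, z)" by (cases s)
  have x: "x \<in> carrier_vec d" and z: "z = b - A *\<^sub>v x" using s by (auto simp: rbls_consistent_def sxz)
  have zc: "z \<in> carrier_vec n" using A b x by (simp add: z)
  have B: "?B \<in> carrier_mat n (card \<tau>)" using block_carrier[OF \<tau>] .
  define w where "w = pinv ?B *\<^sub>v z"
  have w: "w \<in> carrier_vec (card \<tau>)" using pinv_carrier[OF B] zc by (simp add: w_def)
  have Bw: "?B *\<^sub>v w = block_proj \<tau> (rbls_error x)"
    using block_proj_residual[OF \<tau> x] by (simp add: w_def block_proj_def z)
  define x' where "x' = add_on_block x \<tau> w"
  have x': "x' \<in> carrier_vec d" using x by (simp add: x'_def add_on_block_def)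
  have Ax': "A *\<^sub>v x' = A *\<^sub>v x + ?B *\<^sub>v w"
    unfolding x'_def by (rule mult_add_on_block[OF block_subset[OF \<tau>] A x w])
  have step: "rbls_step A \<tau> s = (x', z - ?B *\<^sub>v w)"
    by (simp add: rbls_step_def sxz Let_def x'_def w_def)
  have "z - ?B *\<^sub>v w = b - A *\<^sub>v x'"
    unfolding Ax' z using A B b by (intro eq_vecI) auto
  then show "rbls_consistent (rbls_step A \<tau> s)" using x' by (simp add: rbls_consistent_def step)
  have "rbls_error x' = rbls_error x - ?B *\<^sub>v w"
    unfolding rbls_error_eq[OF x'] rbls_error_eq[OF x] Ax' using A B by (intro eq_vecI) auto
  then show "rbls_error (fst (rbls_step A \<tau> s)) = rbls_error (fst s) - block_proj \<tau> (rbls_error (fst s))"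
    by (simp add: step[unfolded sxz] Bw sxz)
qed

lemma set_pmf_of_paving: "set_pmf (pmf_of_set \<T>) = \<T>"
  using paving_card_pos card_paving finite_paving by (intro set_pmf_of_set) auto

text \<open>Finite support supplies integrability; the invariant is available at every state of
  positive probability.\<close>

lemma rbls_state_support:
  "finite (set_pmf (rbls_state A b \<T> k)) \<and> (\<forall>s\<in>set_pmf (rbls_state A b \<T> k). rbls_consistent s)"
proof (induction k)
  case 0
  then show ?case using A b by (auto simp: rbls_consistent_def)
next
  case (Suc k)
  then show ?case using rbls_step_consistent(1) finite_paving by (auto simp: set_pmf_of_paving)
qed

lemma expected_error:
  "measure_pmf.expectation (rbls_state A b \<T> k) (\<lambda>s. rbls_error (fst s) \<bullet> rbls_error (fst s))
    \<le> rbls_rate ^ k * (range_proj A b \<bullet> range_proj A b)"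
proof (induction k)
  case 0
  \<comment> \<open>Starting from zero, the error is all of
    \<open>A *\<^sub>v x_LS A b\<close>.\<close>
  have "rbls_error (0\<^sub>v d) = range_proj A b"
    using A b x_LS_carrier pinv_carrier[OF A]
    by (simp add: rbls_error_def range_proj_def x_LS_def assoc_mult_mat_vec[of _ n d _ n])
  then show ?case using A by simp
next
  case (Suc k)
  let ?M = "rbls_state A b \<T> k" and ?g = "\<lambda>s. rbls_error (fst s) \<bullet> rbls_error (fst s)"
  have fin: "finite (set_pmf ?M)" and con: "\<And>s. s \<in> set_pmf ?M \<Longrightarrow> rbls_consistent s"
    using rbls_state_support by auto
  have int: "integrable (measure_pmf ?M) f" for f :: "_ \<Rightarrow> real"
    using fin by (rule integrable_measure_pmf_finite)
  have T: "\<T> \<noteq> {}" using paving_card_pos card_paving by auto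
  \<comment> \<open>Conditioning on the state after \<open>k\<close> steps turns the fresh uniform
    block into an average over \<open>\<T>\<close>.\<close>
  have "measure_pmf.expectation (rbls_state A b \<T> (Suc k)) ?g
    = measure_pmf.expectation ?M (\<lambda>s. (\<Sum>\<tau>\<in>\<T>. ?g (rbls_step A \<tau> s)) / real p)"
    using fin finite_paving T card_paving
    by (simp add: pmf_expectation_bind_finite set_pmf_of_paving integral_pmf_of_set)
  also have "\<dots> \<le> measure_pmf.expectation ?M (\<lambda>s. rbls_rate * ?g s)"
  proof (rule integral_mono_AE[OF int int], rule AE_pmfI)
    fix s assume "s \<in> set_pmf ?M"
    then have s: "rbls_consistent s" by (rule con)
    \<comment> \<open>The error is \<open>A\<close> times this vector, so it lies in the range of
      \<open>A\<close>, as the contraction requires.\<close>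
    then have "x_LS A b - fst s \<in> carrier_vec d" using x_LS_carrier by (simp add: rbls_consistent_def)
    from mean_residual_bound[OF this]
    show "(\<Sum>\<tau>\<in>\<T>. ?g (rbls_step A \<tau> s)) / real p \<le> rbls_rate * ?g s"
      by (simp add: rbls_step_consistent(2)[OF _ s] flip: rbls_error_def)
  qed
  also have "\<dots> = rbls_rate * measure_pmf.expectation ?M ?g" by simp
  also have "\<dots> \<le> rbls_rate * (rbls_rate ^ k * (range_proj A b \<bullet> range_proj A b))"
    using Suc rbls_rate_nonneg by (rule mult_left_mono)
  finally show ?case by (simp add: mult.assoc)
qed

end

theorem theorem7:
  fixes A :: "real mat" and b :: "real vec" and n d p T :: nat
    and \<alpha> \<beta> :: real and \<T> :: "nat set set"
  assumes "A \<in> carrier_mat n d" and "A \<noteq> 0\<^sub>m n d"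
    and "b \<in> carrier_vec n"
    and "column_paving A \<T> p \<alpha> \<beta>"
  shows "measure_pmf.expectation (rbls A b \<T> T)
           (\<lambda>x. (l2norm (A *\<^sub>v (x_LS A b - x)))\<^sup>2)
         \<le> (1 - (sigma_min A)\<^sup>2 / (real p * \<beta>)) ^ T * (l2norm (range_proj A b))\<^sup>2"
  using expected_error[OF assms, of T] by (simp add: rbls_def l2norm_sq rbls_error_def[OF assms])

end
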